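(* Let $\Phi$ be the set of all normal contractions. Let $G$ be the set of all $\phi\in\Phi$ such that $|\phi'|=1$ and $\phi'$ has at most two points of discontinuity. Let $\langle G\rangle$ be the collection of all finite compositions of elements of $G$. Then $\langle G\rangle$ is dense in $\Phi$ for the topology of pointwise convergence on $\mathbb{R}$.
   Context: A normal contraction is a $1$-Lipschitz function $\phi:\mathbb{R}\to\mathbb{R}$ with $\phi(0)=0$. The conditions defining $G$ mean that $\phi$ is continuous and piecewise affine with slopes $\pm1$, with at most two points at which the slope changes (and the derivative is undefined). *)

theory Defs
  imports "HOL-Analysis.Analysis"
begin

definition normal_contractions :: "(real \<Rightarrow> real) set" where
  "normal_contractions = {\<phi>. 1-lipschitz_on UNIV \<phi> \<and> \<phi> 0 = 0}"

text \<open>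
  The set \<open>S\<close> holds the exceptional points of the derivative, i.e. those where it does not exist
  or is discontinuous. Away from \<open>S\<close> the derivative exists, is continuous, and has absolute value 1;
  the values of the total function \<^term>\<open>deriv \<phi>\<close> on \<open>S\<close> are irrelevant.
\<close>
definition G :: "(real \<Rightarrow> real) set" where
  "G = {\<phi> \<in> normal_contractions. \<exists>S. finite S \<and> card S \<le> 2 \<and>
          (\<forall>x\<in>-S. \<phi> differentiable (at x) \<and> \<bar>deriv \<phi> x\<bar> = 1) \<and>
          continuous_on (-S) (deriv \<phi>)}"

inductive_set finite_compositions :: "('a \<Rightarrow> 'a) set \<Rightarrow> ('a \<Rightarrow> 'a) set"
  for F :: "('a \<Rightarrow> 'a) set" where
  base: "f \<in> F \<Longrightarrow> f \<in> finite_compositions F"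
| comp: "f \<in> F \<Longrightarrow> g \<in> finite_compositions F \<Longrightarrow> f \<circ> g \<in> finite_compositions F"

definition pointwise_topology :: "(real \<Rightarrow> real) topology" where
  "pointwise_topology = product_topology (\<lambda>_. euclidean) UNIV"

end

theory Submission
  imports Defs
begin

text \<open>
  On every finite set of points a normal contraction agrees \<^emph>\<open>exactly\<close> with some finite composition
  of elements of \<^term>\<open>G\<close>, which is more than density for pointwise convergence. Two facts give this.

  First, a 1-Lipschitz function can be interpolated at finitely many nodes by a zigzag, a
  piecewise affine function of slopes \<open>\<plusminus>1\<close>: between neighbouring nodes at distance \<open>\<Delta>\<close> with
  increment \<open>d\<close>, where \<open>\<bar>d\<bar> \<le> \<Delta>\<close>, it goes up by \<open>(\<Delta> + d)/2\<close> and then down by \<open>(\<Delta> - d)/2\<close>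
  (\<open>zigzag_interpolation\<close>).

  Second, every zigzag is a composition of zigzags with at most two breakpoints. Let \<open>[p, q]\<close> be a
  shortest bounded segment between consecutive breakpoints and \<open>l = q - p\<close>. The segments on both
  sides of it have length at least \<open>l\<close>, so the graph over \<open>[p - l, q + l]\<close> goes up, down and up (or
  down, up and down) by the same amount \<open>l\<close>. The zigzag is therefore constant on the fibres of the
  fold with breakpoints \<open>p\<close> and \<open>q\<close>, and it factors through this fold. The remaining factor is a
  zigzag with two breakpoints fewer (\<open>zigzag_fold\<close>), and induction finishes the argument.

  The normalisation \<open>\<phi> 0 = 0\<close> costs nothing: translations can be inserted between the factors of a
  composition, so that each factor fixes \<open>0\<close> (\<open>zigzag_in_finite_compositions\<close>).
\<close>

section \<open>Zigzag functions\<close>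

text \<open>
  For a sorted list \<open>ps\<close> this is the continuous function that is the identity on the far left and
  whose slope changes sign at each entry of \<open>ps\<close>: to the right of the first breakpoint \<open>p\<close> the
  zigzag of the other breakpoints is reflected at the height \<open>p\<close>. An entry that occurs twice has
  no effect on the slope.
\<close>
fun zigzag :: "real list \<Rightarrow> real \<Rightarrow> real" where
  "zigzag [] x = x"
| "zigzag (p # ps) x = (if x \<le> p then x else 2 * p - zigzag ps x)"

lemma zigzag_left: "\<forall>p\<in>set ps. x \<le> p \<Longrightarrow> zigzag ps x = x"
  by (cases ps) auto

lemma zigzag_shift: "zigzag (map (\<lambda>p. p - t) ps) (x - t) = zigzag ps x - t"
  by (induction ps) auto

lemma zigzag_diff_le:
  assumes "sorted ps" "x \<le> y"
  shows "\<bar>zigzag ps y - zigzag ps x\<bar> \<le> y - x"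
  using assms
proof (induction ps arbitrary: x y)
  case Nil
  then show ?case by simp
next
  case (Cons p ps)
  consider "y \<le> p" | "p < x" | "x \<le> p" "p < y" by linarith
  then show ?case
  proof cases
    case 3
    have "zigzag ps p = p" using Cons.prems by (intro zigzag_left) auto
    moreover have "\<bar>zigzag ps y - zigzag ps p\<bar> \<le> y - p"
      using Cons.IH[of p y] Cons.prems 3 by auto
    ultimately show ?thesis using 3 by simp
  next
    case 2
    then have "\<bar>zigzag ps y - zigzag ps x\<bar> \<le> y - x"
      using Cons.IH[of x y] Cons.prems by auto
    then show ?thesis using 2 Cons.prems by (simp add: abs_minus_commute)
  qed (use Cons.prems in auto)
qed

lemma zigzag_lipschitz:
  assumes "sorted ps"
  shows "1-lipschitz_on UNIV (zigzag ps)"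
proof (rule lipschitz_onI)
  fix x y :: real
  show "dist (zigzag ps x) (zigzag ps y) \<le> 1 * dist x y"
    using zigzag_diff_le[OF assms, of x y] zigzag_diff_le[OF assms, of y x]
    by (cases "x \<le> y") (auto simp: dist_real_def)
qed simp

lemma zigzag_locally_affine:
  assumes "x \<notin> set ps"
  shows "\<exists>s. \<bar>s\<bar> = 1 \<and> (\<forall>\<^sub>F y in nhds x. zigzag ps y = zigzag ps x + s * (y - x))"
  using assms
proof (induction ps)
  case Nil
  show ?case by (rule exI[of _ 1]) simp
next
  case (Cons p ps)
  then obtain s where s: "\<bar>s\<bar> = 1"
    "\<forall>\<^sub>F y in nhds x. zigzag ps y = zigzag ps x + s * (y - x)" by auto
  show ?case
  proof (cases "x < p")
    case True
    then have "\<forall>\<^sub>F y in nhds x. y < p"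
      by (intro eventually_nhds_in_open[of "{..<p}", simplified])
    then have "\<forall>\<^sub>F y in nhds x. zigzag (p # ps) y = zigzag (p # ps) x + 1 * (y - x)"
      by eventually_elim (use True in auto)
    then show ?thesis by (intro exI[of _ 1]) simp
  next
    case False
    then have "p < x" using Cons.prems by auto
    then have "\<forall>\<^sub>F y in nhds x. p < y"
      by (intro eventually_nhds_in_open[of "{p<..}", simplified])
    with s(2) have "\<forall>\<^sub>F y in nhds x. zigzag (p # ps) y = zigzag (p # ps) x + (- s) * (y - x)"
      by eventually_elim (use \<open>p < x\<close> in \<open>auto simp: algebra_simps\<close>)
    then show ?thesis using s(1) by (intro exI[of _ "- s"]) simp
  qed
qed

section \<open>Folding along a shortest segment\<close>

text \<open>
  With \<open>l = q - p\<close>, the fold \<^term>\<open>zigzag [p, q]\<close> maps each of the three segments \<open>[p - l, p]\<close>,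
  \<open>[p, q]\<close> and \<open>[q, q + l]\<close> isometrically onto \<open>[p - l, p]\<close>, and it moves everything to the right
  of \<open>q\<close> by \<open>- 2 * l\<close>. The bounds on \<open>us\<close> and \<open>vs\<close> keep the other breakpoints out of the interior
  of these segments, so the zigzag takes equal values at points that the fold identifies.
\<close>
lemma zigzag_fold:
  assumes "p \<le> q" "\<forall>u\<in>set us. u \<le> p - (q - p)" "\<forall>v\<in>set vs. q + (q - p) \<le> v" "sorted us"
  shows "zigzag (us @ p # q # vs) x =
    zigzag (us @ map (\<lambda>v. v - 2 * (q - p)) vs) (zigzag [p, q] x)"
  using assms(2,4)
proof (induction us)
  case Nil
  show ?case
  proof (cases "x \<le> q")
    case True
    then have "zigzag [p, q] x \<le> p" by auto
    then have "\<forall>v\<in>set (map (\<lambda>v. v - 2 * (q - p)) vs). zigzag [p, q] x \<le> v"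
      using assms(3) by (fastforce simp del: zigzag.simps)
    from zigzag_left[OF this] show ?thesis using True by simp
  next
    case False
    then have "zigzag [p, q] x = x - 2 * (q - p)" using assms(1) by simp
    then show ?thesis using False assms(1) by (simp add: zigzag_shift del: zigzag.simps) simp
  qed
next
  case (Cons u us)
  let ?y = "zigzag [p, q] x"
  have IH: "zigzag (us @ p # q # vs) x =
      zigzag (us @ map (\<lambda>v. v - 2 * (q - p)) vs) ?y"
    using Cons by simp
  have u: "u \<le> p - (q - p)" using Cons.prems by simp
  consider "x \<le> u" | "u < x" "u < ?y" | "u < x" "?y \<le> u" by linarith
  then show ?case
  proof cases
    case 1
    then show ?thesis using u assms(1) by simp
  next
    case 2
    then show ?thesis using IH by (simp del: zigzag.simps(2) add: zigzag.simps(2)[of u])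
  next
    (* The fold keeps points on their side of u, except that x = q may be mapped to u = p - l;
       both branches of the definition agree there. *)
    case 3
    then have y: "?y = u" using u assms(1) by (auto split: if_splits)
    have "\<forall>w\<in>set (us @ map (\<lambda>v. v - 2 * (q - p)) vs). u \<le> w"
      using Cons.prems assms(1,3) by fastforce
    from zigzag_left[OF this] show ?thesis using IH 3(1) y by simp
  qed
qed

lemma sorted_shortest_gap:
  fixes ps :: "real list"
  assumes "sorted ps" "2 \<le> length ps"
  obtains us p q vs where "ps = us @ p # q # vs" "p \<le> q"
    "\<forall>u\<in>set us. u \<le> p - (q - p)" "\<forall>v\<in>set vs. q + (q - p) \<le> v"
proof -
  let ?gap = "\<lambda>i. ps ! Suc i - ps ! i"
  obtain i where i: "Suc i < length ps" and min: "\<And>j. Suc j < length ps \<Longrightarrow> ?gap i \<le> ?gap j"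
  proof -
    have "finite {i. Suc i < length ps}" "{i. Suc i < length ps} \<noteq> {}"
      using assms(2) by (auto intro!: exI[of _ 0] finite_subset[of _ "{..<length ps}"])
    then have "\<exists>i. is_arg_min ?gap (\<lambda>i. i \<in> {i. Suc i < length ps}) i"
      by (rule ex_is_arg_min_if_finite)
    then show thesis using that by (auto simp: is_arg_min_linorder)
  qed
  let ?p = "ps ! i" and ?q = "ps ! Suc i"
  show thesis
  proof
    show "ps = take i ps @ ?p # ?q # drop (Suc (Suc i)) ps"
      using i by (metis Cons_nth_drop_Suc Suc_lessD append_take_drop_id)
    show "?p \<le> ?q" using i assms(1) by (simp add: sorted_nth_mono)
    show "\<forall>u\<in>set (take i ps). u \<le> ?p - (?q - ?p)"
    proof
      fix u assume "u \<in> set (take i ps)"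
      then obtain j where j: "j < i" "u = ps ! j" using i by (auto simp: in_set_conv_nth)
      then have "u \<le> ps ! (i - 1)" using i assms(1) by (simp add: sorted_nth_mono)
      then show "u \<le> ?p - (?q - ?p)" using min[of "i - 1"] i j by simp
    qed
    show "\<forall>v\<in>set (drop (Suc (Suc i)) ps). ?q + (?q - ?p) \<le> v"
    proof
      fix v assume "v \<in> set (drop (Suc (Suc i)) ps)"
      then obtain j where "j < length (drop (Suc (Suc i)) ps)" "v = drop (Suc (Suc i)) ps ! j"
        by (metis in_set_conv_nth)
      then have j: "Suc (Suc i) + j < length ps" "v = ps ! (Suc (Suc i) + j)" by auto
      then have "ps ! Suc (Suc i) \<le> v" using assms(1) by (simp add: sorted_nth_mono)
      then show "?q + (?q - ?p) \<le> v" using min[of "Suc i"] j by simp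
    qed
  qed
qed

section \<open>Zigzags as compositions of elements of \<open>G\<close>\<close>

lemma normal_contractions_comp:
  assumes "f \<in> normal_contractions" "g \<in> normal_contractions"
  shows "f \<circ> g \<in> normal_contractions"
proof -
  have "1-lipschitz_on UNIV g" "1-lipschitz_on (range g) f"
    using assms by (auto simp: normal_contractions_def intro: lipschitz_on_subset)
  then have "1-lipschitz_on UNIV (f \<circ> g)"
    using lipschitz_on_compose[of 1 UNIV g 1 f] by simp
  then show ?thesis using assms by (simp add: normal_contractions_def)
qed

lemma finite_compositions_closed:
  assumes "f \<in> finite_compositions F" "g \<in> finite_compositions F"
  shows "f \<circ> g \<in> finite_compositions F"
  using assms(1)
proof induction
  case (base f)
  then show ?case using assms(2) by (rule finite_compositions.comp)
next
  case (comp f h)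
  show ?case
    unfolding comp_assoc by (rule finite_compositions.comp[OF comp.hyps(1) comp.IH])
qed

lemma finite_compositions_G_subset: "finite_compositions G \<subseteq> normal_contractions"
proof
  fix f assume "f \<in> finite_compositions G"
  then show "f \<in> normal_contractions"
  proof induction
    case (base f)
    then show ?case by (simp add: G_def)
  next
    case (comp f g)
    then show ?case by (intro normal_contractions_comp) (auto simp: G_def)
  qed
qed

lemma locally_affine_imp_deriv:
  fixes g :: "real \<Rightarrow> real"
  assumes "\<forall>\<^sub>F y in nhds x. g y = c + s * (y - x)"
  shows "\<forall>\<^sub>F z in nhds x. (g has_real_derivative s) (at z)"
  using assms[THEN eventually_eventually[THEN iffD2]]
proof eventually_elim
  case (elim z)
  have "((\<lambda>y. c + s * (y - x)) has_real_derivative s) (at z)"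
    by (auto intro!: derivative_eq_intros)
  then show ?case using DERIV_cong_ev[OF refl elim refl] by simp
qed

lemma zigzag_in_G:
  assumes "sorted ps" "length ps \<le> 2"
  shows "(\<lambda>x. zigzag ps (x + a) - zigzag ps a) \<in> G"
proof -
  let ?g = "\<lambda>x. zigzag ps (x + a) - zigzag ps a"
  let ?S = "(\<lambda>p. p - a) ` set ps"
  have "1-lipschitz_on UNIV ?g"
  proof (rule lipschitz_onI)
    show "dist (?g x) (?g y) \<le> 1 * dist x y" for x y
      using lipschitz_onD[OF zigzag_lipschitz[OF assms(1)], of "x + a" "y + a"]
      by (simp add: dist_real_def)
  qed simp
  then have "?g \<in> normal_contractions" by (simp add: normal_contractions_def)
  moreover have "card ?S \<le> 2"
    using card_image_le[of "set ps" "\<lambda>p. p - a"] card_length[of ps] assms(2) by simp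
  moreover have "?g differentiable (at x) \<and> \<bar>deriv ?g x\<bar> = 1 \<and> isCont (deriv ?g) x"
    if "x \<in> - ?S" for x
  proof -
    have "x + a \<notin> set ps" using that by force
    then obtain s where s: "\<bar>s\<bar> = 1"
      "\<forall>\<^sub>F y in nhds (x + a). zigzag ps y = zigzag ps (x + a) + s * (y - (x + a))"
      using zigzag_locally_affine by blast
    have "filterlim (\<lambda>y. y + a) (nhds (x + a)) (nhds x)"
      by (intro tendsto_intros filterlim_ident)
    from eventually_compose_filterlim[OF s(2) this]
    have "\<forall>\<^sub>F y in nhds x. ?g y = ?g x + s * (y - x)"
      by eventually_elim simp
    from locally_affine_imp_deriv[OF this]
    have d: "\<forall>\<^sub>F z in nhds x. (?g has_real_derivative s) (at z)" .
    then have "\<forall>\<^sub>F z in nhds x. deriv ?g z = s"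
      by eventually_elim (rule DERIV_imp_deriv)
    then have "isCont (deriv ?g) x \<longleftrightarrow> isCont (\<lambda>_. s) x" by (rule isCont_cong)
    moreover from eventually_nhds_x_imp_x[OF d] have "(?g has_real_derivative s) (at x)" .
    ultimately show ?thesis
      using s(1) DERIV_imp_deriv real_differentiable_def by auto
  qed
  ultimately show ?thesis
    unfolding G_def
    by (intro CollectI conjI exI[of _ ?S]) (auto simp: continuous_at_imp_continuous_on)
qed

text \<open>
  The base point \<open>a\<close> is arbitrary because the induction moves it: the inner fold of a factorisation
  maps \<open>a\<close> to the base point of the outer zigzag.
\<close>
lemma zigzag_in_finite_compositions:
  assumes "sorted ps"
  shows "(\<lambda>x. zigzag ps (x + a) - zigzag ps a) \<in> finite_compositions G"
  using assms
proof (induction "length ps" arbitrary: ps a rule: less_induct)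
  case less
  show ?case
  proof (cases "length ps \<le> 2")
    case True
    then show ?thesis using less.prems by (intro finite_compositions.base zigzag_in_G)
  next
    case False
    then have "2 \<le> length ps" by simp
    from sorted_shortest_gap[OF less.prems this]
    obtain us p q vs where ps: "ps = us @ p # q # vs" "p \<le> q"
      and us: "\<forall>u\<in>set us. u \<le> p - (q - p)" and vs: "\<forall>v\<in>set vs. q + (q - p) \<le> v"
      by metis
    define qs where "qs = us @ map (\<lambda>v. v - 2 * (q - p)) vs"
    define b where "b = zigzag [p, q] a"
    have us_sorted: "sorted us" and vs_sorted: "sorted vs"
      using less.prems by (simp_all add: ps(1) sorted_append)
    have fold: "zigzag ps x = zigzag qs (zigzag [p, q] x)" for x
      unfolding ps(1) qs_def by (rule zigzag_fold[OF ps(2) us vs us_sorted])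
    have "sorted (map (\<lambda>v. v - 2 * (q - p)) vs)"
      using vs_sorted by (simp add: sorted_map)
    moreover have "u \<le> v - 2 * (q - p)" if "u \<in> set us" "v \<in> set vs" for u v
      using bspec[OF us that(1)] bspec[OF vs that(2)] ps(2) by argo
    ultimately have "sorted qs"
      unfolding qs_def sorted_append set_map using us_sorted by blast
    then have "(\<lambda>x. zigzag qs (x + b) - zigzag qs b) \<in> finite_compositions G"
      by (intro less.hyps) (simp_all add: ps(1) qs_def)
    moreover have "(\<lambda>x. zigzag [p, q] (x + a) - b) \<in> finite_compositions G"
      unfolding b_def using ps(2) by (intro finite_compositions.base zigzag_in_G) auto
    ultimately have "(\<lambda>x. zigzag qs (x + b) - zigzag qs b) \<circ> (\<lambda>x. zigzag [p, q] (x + a) - b)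
        \<in> finite_compositions G"
      by (rule finite_compositions_closed)
    then show ?thesis by (simp add: fold b_def o_def del: zigzag.simps)
  qed
qed

section \<open>Interpolation and density\<close>

lemma zigzag_interpolation:
  assumes "1-lipschitz_on UNIV \<phi>" "sorted (x0 # xs)"
  shows "\<exists>ps. sorted ps \<and> (\<forall>p\<in>set ps. x0 \<le> p) \<and>
    (\<forall>x\<in>set (x0 # xs). \<phi> x - \<phi> x0 = zigzag ps x - x0)"
  using assms(2)
proof (induction xs arbitrary: x0)
  case Nil
  show ?case by (rule exI[of _ "[]"]) simp
next
  case (Cons x1 xs)
  then have "sorted (x1 # xs)" by simp
  from Cons.IH[OF this] obtain ps where ps: "sorted ps" "\<forall>p\<in>set ps. x1 \<le> p"
    "\<forall>x\<in>set (x1 # xs). \<phi> x - \<phi> x1 = zigzag ps x - x1"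
    by blast
  have "x0 \<le> x1" using Cons.prems by simp
  moreover have "\<bar>\<phi> x1 - \<phi> x0\<bar> \<le> \<bar>x1 - x0\<bar>"
    using lipschitz_onD[OF assms(1), of x1 x0] by (simp add: dist_real_def)
  ultimately have d: "\<bar>\<phi> x1 - \<phi> x0\<bar> \<le> x1 - x0" by simp
  \<comment> \<open>The peak between the nodes \<open>x0\<close> and \<open>x1\<close>; the slope becomes positive again at \<open>x1\<close>.\<close>
  define m where "m = x0 + ((x1 - x0) + (\<phi> x1 - \<phi> x0)) / 2"
  have m: "x0 \<le> m" "m \<le> x1" using d unfolding m_def abs_le_iff by (simp_all add: field_simps)
  have "\<phi> x - \<phi> x0 = zigzag (m # x1 # ps) x - x0" if x: "x \<in> set (x1 # xs)" for x
  proof -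
    have "x1 \<le> x" using x Cons.prems by auto
    have "zigzag (m # x1 # ps) x = 2 * m - 2 * x1 + zigzag ps x"
      using \<open>x1 \<le> x\<close> m zigzag_left[OF ps(2)] by (cases "x = x1") auto
    moreover have "\<phi> x - \<phi> x1 = zigzag ps x - x1" using ps(3) x by blast
    ultimately show ?thesis unfolding m_def by argo
  qed
  moreover have "zigzag (m # x1 # ps) x0 = x0" using m by simp
  ultimately show ?case
    using ps m by (intro exI[of _ "m # x1 # ps"]) (auto simp del: zigzag.simps)
qed

lemma finite_compositions_G_interpolate:
  assumes "\<phi> \<in> normal_contractions" "finite X"
  obtains h where "h \<in> finite_compositions G" "\<forall>x\<in>X. h x = \<phi> x"
proof -
  obtain x0 xs where xs: "sorted_list_of_set (insert 0 X) = x0 # xs"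
    using assms(2) by (metis finite_insert insert_not_empty list.exhaust sorted_list_of_set_eq_Nil_iff)
  have set: "set (x0 # xs) = insert 0 X"
    unfolding xs[symmetric] using assms(2)
    by (simp only: set_sorted_list_of_set finite_insert)
  have "sorted (x0 # xs)" unfolding xs[symmetric] by (rule sorted_sorted_list_of_set)
  then obtain ps where ps: "sorted ps" "\<forall>x\<in>insert 0 X. \<phi> x - \<phi> x0 = zigzag ps x - x0"
    using zigzag_interpolation[of \<phi> x0 xs] assms(1) unfolding set
    by (auto simp: normal_contractions_def)
  show thesis
  proof
    show "(\<lambda>x. zigzag ps (x + 0) - zigzag ps 0) \<in> finite_compositions G"
      using ps(1) by (rule zigzag_in_finite_compositions)
    have "\<phi> 0 = 0" using assms(1) by (simp add: normal_contractions_def)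
    then show "\<forall>x\<in>X. zigzag ps (x + 0) - zigzag ps 0 = \<phi> x"
      using ps(2) by (smt (verit) insertCI)
  qed
qed

text \<open>A basic neighbourhood for pointwise convergence constrains the values at finitely many points.\<close>
lemma in_pointwise_closure_if_interpolated:
  assumes "\<And>X. finite X \<Longrightarrow> \<exists>h\<in>H. \<forall>x\<in>X. h x = \<phi> x"
  shows "\<phi> \<in> pointwise_topology closure_of H"
  unfolding in_closure_of
proof (intro conjI allI impI)
  show "\<phi> \<in> topspace pointwise_topology" by (simp add: pointwise_topology_def)
  fix T assume T: "\<phi> \<in> T \<and> openin pointwise_topology T"
  obtain U where U: "finite {i. U i \<noteq> UNIV}" "\<phi> \<in> Pi\<^sub>E UNIV U" "Pi\<^sub>E UNIV U \<subseteq> T"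
    using T[unfolded pointwise_topology_def openin_product_topology_alt, THEN conjunct2, THEN bspec,
      OF T[THEN conjunct1]] by auto
  from assms[OF U(1)] obtain h where "h \<in> H" "\<forall>x\<in>{i. U i \<noteq> UNIV}. h x = \<phi> x" by blast
  moreover from this U(2) have "h \<in> Pi\<^sub>E UNIV U" by (fastforce simp: PiE_iff)
  ultimately show "\<exists>y. y \<in> H \<and> y \<in> T" using U(3) by blast
qed

theorem lemma1p4:
  shows "finite_compositions G \<subseteq> normal_contractions \<and>
         subtopology pointwise_topology normal_contractions closure_of finite_compositions G
           = normal_contractions"
proof (intro conjI finite_compositions_G_subset)
  have "normal_contractions \<subseteq> pointwise_topology closure_of finite_compositions G"
  proof
    fix \<phi> assume \<phi>: "\<phi> \<in> normal_contractions"
    show "\<phi> \<in> pointwise_topology closure_of finite_compositions G"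
    proof (rule in_pointwise_closure_if_interpolated)
      fix X :: "real set" assume "finite X"
      from finite_compositions_G_interpolate[OF \<phi> this]
      show "\<exists>h\<in>finite_compositions G. \<forall>x\<in>X. h x = \<phi> x" by blast
    qed
  qed
  moreover have "normal_contractions \<inter> finite_compositions G = finite_compositions G"
    using finite_compositions_G_subset by blast
  ultimately show "subtopology pointwise_topology normal_contractions closure_of finite_compositions G
      = normal_contractions"
    by (simp add: closure_of_subtopology Int_absorb2)
qed

end
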